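(* Let $\mu>0$ and, for every $\xi\sim\mathcal{D}$, let $A_\xi:\mathcal{X}\to 2^{\mathcal{X}}$ be $\mu$-strongly maximally monotone. Let $A=\mathrm{E}_{\xi\sim\mathcal{D}}[A_\xi]$ and let $x^\star$ be the (unique) solution of $0\in A(x^\star)$. Let $(a_\xi^\star)_\xi$ satisfy $a_\xi^\star\in A_\xi(x^\star)$ for every $\xi\sim\mathcal{D}$ and $\mathrm{E}_{\xi\sim\mathcal{D}}[a_\xi^\star]=0$ (such a family exists by definition of $x^\star$; if it is not unique, take one minimizing $\mathrm{E}_{\xi\sim\mathcal{D}}[\|a_\xi^\star\|^2]$), and set $$\sigma_\star^2:=\mathrm{E}_{\xi\sim\mathcal{D}}\left[\|a_\xi^\star\|^2\right].$$ Let $\gamma>0$ and $x^0\in\mathcal{X}$ be arbitrary, and let $(x^k)_{k\ge 0}$ be generated by the Stochastic Proximal Point Method $$x^{k+1}:=(I+\gamma A_{\xi^k})^{-1}(x^k),\qquad \xi^k\sim\mathcal{D},\quad k=0,1,\ldots$$ Then, for every $k\ge 0$, $$\mathrm{E}\left[\|x^k-x^\star\|^2\right]\le\left(\frac{1}{1+\gamma\mu}\right)^{2k}\|x^0-x^\star\|^2+\frac{1-(1+\gamma\mu)^{-2k}}{(1+\gamma\mu)^2-1}\,\gamma^2\sigma_\star^2\le\left(\frac{1}{1+\gamma\mu}\right)^{2k}\|x^0-x^\star\|^2+\frac{\gamma\sigma_\star^2}{2\mu+\gamma\mu^2}.$$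
   Context: $\mathcal{X}$ is a finite-dimensional real Hilbert space with inner product $\langle\cdot,\cdot\rangle$ and norm $\|\cdot\|$; $I$ is the identity. $\mathcal{D}$ is a probability distribution, and the $\xi^k$ are sampled from $\mathcal{D}$ independently of each other ($\xi^k$ is independent of $x^0,\dots,x^k$). A set-valued operator $B:\mathcal{X}\to 2^{\mathcal{X}}$ has graph $\mathrm{gra}(B)=\{(x,u):u\in B(x)\}$. $B$ is monotone if $\langle u-v,x-y\rangle\ge 0$ for all $(x,u),(y,v)\in\mathrm{gra}(B)$; maximally monotone if moreover no monotone operator has a graph strictly containing $\mathrm{gra}(B)$; $\mu$-strongly maximally monotone if it is maximally monotone and $\langle u-v,x-y\rangle\ge\mu\|x-y\|^2$ for all $(x,u),(y,v)\in\mathrm{gra}(B)$. If $B$ is maximally monotone, the resolvent $(I+B)^{-1}$ is defined everywhere and single-valued. The operator $A=\mathrm{E}_{\xi\sim\mathcal{D}}[A_\xi]$ is understood through selections: $u\in A(x)$ if and only if there is a (measurable, integrable) family $a_\xi\in A_\xi(x)$ with $\mathrm{E}_{\xi\sim\mathcal{D}}[a_\xi]=u$. A solution $x^\star$ of $0\in A(x^\star)$ is assumed to exist (it is then unique, by strong monotonicity). The dependence of $A_\xi$ on $\xi$ is implicitly assumed measurable enough for the expectations to make sense. *)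

theory Defs
  imports "HOL-Probability.Probability"
begin

text \<open>A set-valued operator on a space is a function of type \<open>'a \<Rightarrow> 'a set\<close>.\<close>

definition gra :: "('a \<Rightarrow> 'b set) \<Rightarrow> ('a \<times> 'b) set"
  where "gra B = {(x, u). u \<in> B x}"

definition monotone_op :: "('a::real_inner \<Rightarrow> 'a set) \<Rightarrow> bool"
  where "monotone_op B \<longleftrightarrow>
    (\<forall>(x, u) \<in> gra B. \<forall>(y, v) \<in> gra B. (u - v) \<bullet> (x - y) \<ge> 0)"

definition maximally_monotone :: "('a::real_inner \<Rightarrow> 'a set) \<Rightarrow> bool"
  where "maximally_monotone B \<longleftrightarrow>
    monotone_op B \<and> \<not> (\<exists>C. monotone_op C \<and> gra B \<subset> gra C)"

definition strongly_maximally_monotone :: "real \<Rightarrow> ('a::real_inner \<Rightarrow> 'a set) \<Rightarrow> bool"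
  where "strongly_maximally_monotone \<mu> B \<longleftrightarrow> maximally_monotone B \<and>
    (\<forall>(x, u) \<in> gra B. \<forall>(y, v) \<in> gra B. (u - v) \<bullet> (x - y) \<ge> \<mu> * (norm (x - y))\<^sup>2)"

definition scale_op :: "real \<Rightarrow> ('a::real_vector \<Rightarrow> 'a set) \<Rightarrow> 'a \<Rightarrow> 'a set"
  where "scale_op c B x = (\<lambda>u. c *\<^sub>R u) ` B x"

definition op_inverse :: "('a \<Rightarrow> 'b set) \<Rightarrow> 'b \<Rightarrow> 'a set"
  where "op_inverse B u = {x. u \<in> B x}"

text \<open>The resolvent \<open>(I + B)\<^sup>-\<^sup>1\<close>, as a set-valued operator. When \<open>B\<close> is maximally monotone
  each of its values is a singleton, so that \<open>y \<in> resolvent B x\<close> says \<open>y = (I + B)\<^sup>-\<^sup>1(x)\<close>.\<close>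

definition resolvent :: "('a::real_vector \<Rightarrow> 'a set) \<Rightarrow> 'a \<Rightarrow> 'a set"
  where "resolvent B = op_inverse (\<lambda>x. (\<lambda>u. x + u) ` B x)"

text \<open>The usual (Effros) measurability of the closed-valued map \<open>\<xi> \<mapsto> gra (A \<xi>)\<close>. For maximally
  monotone operators it is equivalent to measurability of \<open>\<xi> \<mapsto> (I + \<gamma> A \<xi>)\<^sup>-\<^sup>1(x)\<close> for every
  \<open>x\<close>, for one or for all \<open>\<gamma> > 0\<close>.\<close>

definition measurable_op_family ::
    "'s measure \<Rightarrow> ('s \<Rightarrow> 'a::topological_space \<Rightarrow> 'a set) \<Rightarrow> bool"
  where "measurable_op_family D A \<longleftrightarrow>
    (\<forall>U. open U \<longrightarrow> {\<xi> \<in> space D. gra (A \<xi>) \<inter> U \<noteq> {}} \<in> sets D)"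

definition selections ::
    "'s measure \<Rightarrow> ('s \<Rightarrow> 'a \<Rightarrow> 'a set) \<Rightarrow> 'a \<Rightarrow> 'a \<Rightarrow> ('s \<Rightarrow> 'a::euclidean_space) set"
  where "selections D A x u =
    {a. (\<forall>\<xi> \<in> space D. a \<xi> \<in> A \<xi> x) \<and> integrable D a \<and> (\<integral>\<xi>. a \<xi> \<partial>D) = u}"

definition mean_op ::
    "'s measure \<Rightarrow> ('s \<Rightarrow> 'a \<Rightarrow> 'a set) \<Rightarrow> 'a::euclidean_space \<Rightarrow> 'a set"
  where "mean_op D A x = {u. \<exists>a. a \<in> selections D A x u}"

text \<open>The expected squared norm takes values in \<open>[0, \<infinity>]\<close>, so that no second moment has to
  be assumed finite.\<close>

definition mean_sq_norm :: "'s measure \<Rightarrow> ('s \<Rightarrow> 'a::real_normed_vector) \<Rightarrow> ennreal"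
  where "mean_sq_norm M f = (\<integral>\<^sup>+ s. ennreal ((norm (f s))\<^sup>2) \<partial>M)"

end

theory Submission
  imports Defs
begin

text \<open>The point \<open>xstar\<close> is the resolvent of \<open>xstar + \<gamma> *\<^sub>R astar s\<close>, and strong monotonicity makes
  the resolvent a contraction with factor \<open>1 / (1 + \<gamma> * \<mu>)\<close>. Hence
  \<open>norm (x (Suc k) - xstar) \<le> norm (x k - xstar - \<gamma> *\<^sub>R astar (\<xi> k)) / (1 + \<gamma> * \<mu>)\<close>. Squaring and
  taking expectations, the cross term vanishes, since \<open>astar\<close> has mean zero and \<open>\<xi> k\<close> is
  independent of \<open>x k\<close>; the resulting linear recursion is solved by the stated bound.\<close>

section \<open>The resolvent of a strongly monotone operator\<close>

lemma resolvent_scale_op_iff: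
  "p \<in> resolvent (scale_op c B) y \<longleftrightarrow> (\<exists>u. u \<in> B p \<and> y = p + c *\<^sub>R u)"
  by (auto simp: resolvent_def op_inverse_def scale_op_def)

text \<open>Strong monotonicity makes \<open>(y - z) \<bullet> (p - q)\<close> at least
  \<open>(1 + \<gamma> * \<mu>)\<close> times the squared distance of \<open>p\<close> and
  \<open>q\<close>; Cauchy-Schwarz bounds it from above, and one factor \<open>norm (p - q)\<close>
  cancels.\<close>

lemma resolvent_contraction:
  fixes B :: "'a::real_inner \<Rightarrow> 'a set"
  assumes B: "strongly_maximally_monotone \<mu> B" and "\<gamma> > 0"
    and p: "p \<in> resolvent (scale_op \<gamma> B) y" and q: "q \<in> resolvent (scale_op \<gamma> B) z"
  shows "(1 + \<gamma> * \<mu>) * norm (p - q) \<le> norm (y - z)"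
proof -
  from p q obtain u v where u: "u \<in> B p" "y = p + \<gamma> *\<^sub>R u" and v: "v \<in> B q" "z = q + \<gamma> *\<^sub>R v"
    by (auto simp: resolvent_scale_op_iff)
  have "\<mu> * (norm (p - q))\<^sup>2 \<le> (u - v) \<bullet> (p - q)"
    using B u v by (auto simp: strongly_maximally_monotone_def gra_def)
  then have "\<gamma> * (\<mu> * (norm (p - q))\<^sup>2) \<le> \<gamma> * ((u - v) \<bullet> (p - q))"
    using \<open>\<gamma> > 0\<close> by simp
  then have "(1 + \<gamma> * \<mu>) * (norm (p - q))\<^sup>2 \<le> (p - q) \<bullet> (p - q) + \<gamma> * ((u - v) \<bullet> (p - q))"
    by (simp add: algebra_simps power2_norm_eq_inner)
  also have "\<dots> = (y - z) \<bullet> (p - q)"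
    by (simp add: u v inner_diff_left inner_add_left algebra_simps)
  also have "\<dots> \<le> norm (y - z) * norm (p - q)"
    by (rule norm_cauchy_schwarz)
  finally have "((1 + \<gamma> * \<mu>) * norm (p - q)) * norm (p - q) \<le> norm (y - z) * norm (p - q)"
    by (simp add: power2_eq_square mult.assoc)
  then show ?thesis
    by (cases "p = q") auto
qed

text \<open>As the resolvent is nonexpansive on its domain, its value at \<open>y\<close> lies
  within \<open>3 * r\<close> of \<open>q\<close> as soon as \<open>y\<close> is within \<open>r\<close> of some \<open>z\<close> such that the ball of radius \<open>r\<close>
  around \<open>(z, q)\<close> meets the graph of the resolvent. Countably many \<open>z\<close>, \<open>q\<close>, \<open>r\<close> suffice.\<close>

lemma borel_measurable_resolvent_step:
  fixes A :: "'s \<Rightarrow> 'a::euclidean_space \<Rightarrow> 'a set"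
  assumes A: "measurable_op_family D A"
    and mono: "\<And>s. s \<in> space D \<Longrightarrow> strongly_maximally_monotone \<mu> (A s)"
    and "\<mu> > 0" "\<gamma> > 0"
    and X[measurable]: "X \<in> borel_measurable N" and Y[measurable]: "Y \<in> measurable N D"
    and Z: "\<And>\<omega>. \<omega> \<in> space N \<Longrightarrow> Z \<omega> \<in> resolvent (scale_op \<gamma> (A (Y \<omega>))) (X \<omega>)"
  shows "Z \<in> borel_measurable N"
proof (rule borel_measurableI)
  fix U :: "'a set" assume "open U"
  obtain C :: "'a set" where C: "countable C"
    "\<And>S. open S \<Longrightarrow> S \<noteq> {} \<Longrightarrow> \<exists>d\<in>C. d \<in> S"
    using countable_dense_exists by blast
  define r where "r n = 1 / real (Suc n)" for n
  have r_pos: "r n > 0" for n by (simp add: r_def)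
  \<comment> \<open>For \<open>w\<close> in the graph of \<open>A s\<close>, the resolvent of
    \<open>scale_op \<gamma> (A s)\<close> takes the value \<open>fst w\<close> at
    \<open>fst w + \<gamma> *\<^sub>R snd w\<close>. This point depends continuously on
    \<open>w\<close>, so the condition cuts out an open set of pairs, as
    \<open>measurable_op_family\<close> requires.\<close>
  define H where
    "H z q n = {s \<in> space D. gra (A s) \<inter> {w. fst w + \<gamma> *\<^sub>R snd w \<in> ball z (r n) \<and> fst w \<in> ball q (r n)} \<noteq> {}}"
    for z q n
  have H[measurable]: "H z q n \<in> sets D" for z q n
  proof -
    have "open ((\<lambda>w::'a \<times> 'a. fst w + \<gamma> *\<^sub>R snd w) -` ball z (r n) \<inter> fst -` ball q (r n))"
      by (intro open_Int open_vimage continuous_intros) auto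
    also have "(\<lambda>w::'a \<times> 'a. fst w + \<gamma> *\<^sub>R snd w) -` ball z (r n) \<inter> fst -` ball q (r n)
      = {w. fst w + \<gamma> *\<^sub>R snd w \<in> ball z (r n) \<and> fst w \<in> ball q (r n)}" by auto
    finally show ?thesis
      using A unfolding measurable_op_family_def H_def by blast
  qed
  have H_iff: "Y \<omega> \<in> H z q n \<longleftrightarrow>
      (\<exists>p y. p \<in> resolvent (scale_op \<gamma> (A (Y \<omega>))) y \<and> dist z y < r n \<and> dist q p < r n)"
    if "\<omega> \<in> space N" for z q n \<omega>
    using measurable_space[OF Y that]
    by (fastforce simp: H_def gra_def resolvent_scale_op_iff)
  \<comment> \<open>The radius \<open>3 * r n\<close> splits as 1 + 2: \<open>q\<close> is within
    \<open>r n\<close> of \<open>p\<close>, while \<open>X \<omega>\<close> and \<open>y\<close> are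
    both within \<open>r n\<close> of \<open>z\<close>, which puts \<open>Z \<omega>\<close> within
    \<open>2 * r n\<close> of \<open>p\<close>.\<close>
  define P where "P = {(z, q, n). z \<in> C \<and> q \<in> C \<and> ball q (3 * r n) \<subseteq> U}"
  have "P \<subseteq> C \<times> C \<times> UNIV" by (auto simp: P_def)
  then have "countable P"
    by (rule countable_subset) (intro countable_SIGMA C(1) countableI_type)
  have eq: "Z -` U \<inter> space N =
    (\<Union>(z, q, n)\<in>P. {\<omega> \<in> space N. dist (X \<omega>) z < r n \<and> Y \<omega> \<in> H z q n})" (is "_ = ?R")
  proof (intro set_eqI iffI)
    fix \<omega> assume *: "\<omega> \<in> Z -` U \<inter> space N"
    then obtain e where e: "e > 0" "ball (Z \<omega>) e \<subseteq> U"
      using \<open>open U\<close> open_contains_ball by blast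
    \<comment> \<open>A point within \<open>3 * r n\<close> of \<open>q\<close> is within
      \<open>4 * r n\<close> of \<open>Z \<omega>\<close>, hence the quarter.\<close>
    obtain n where n: "r n < e / 4"
      using nat_approx_posE[of "e / 4"] e(1) unfolding r_def by auto
    obtain z where z: "z \<in> C" "z \<in> ball (X \<omega>) (r n)"
      using C(2)[of "ball (X \<omega>) (r n)"] r_pos[of n] by auto
    obtain q where q: "q \<in> C" "q \<in> ball (Z \<omega>) (r n)"
      using C(2)[of "ball (Z \<omega>) (r n)"] r_pos[of n] by auto
    have "ball q (3 * r n) \<subseteq> ball (Z \<omega>) e"
    proof
      fix w assume "w \<in> ball q (3 * r n)"
      then show "w \<in> ball (Z \<omega>) e"
        using q(2) n dist_triangle[of "Z \<omega>" w q] by simp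
    qed
    then have "(z, q, n) \<in> P" using e z q by (auto simp: P_def)
    moreover have "Y \<omega> \<in> H z q n"
      using * z q Z[of \<omega>] by (subst H_iff, simp) (intro exI[of _ "Z \<omega>"] exI[of _ "X \<omega>"], auto simp: dist_commute)
    ultimately show "\<omega> \<in> ?R" using * z by (auto intro!: bexI[of _ "(z, q, n)"])
  next
    fix \<omega> assume "\<omega> \<in> ?R"
    then obtain z q n where *: "\<omega> \<in> space N" "ball q (3 * r n) \<subseteq> U" "dist (X \<omega>) z < r n"
      "Y \<omega> \<in> H z q n" by (auto simp: P_def)
    then obtain p y where p: "p \<in> resolvent (scale_op \<gamma> (A (Y \<omega>))) y" "dist z y < r n" "dist q p < r n"
      by (auto simp: H_iff)
    have "norm (Z \<omega> - p) \<le> (1 + \<gamma> * \<mu>) * norm (Z \<omega> - p)"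
      using \<open>\<mu> > 0\<close> \<open>\<gamma> > 0\<close> by (simp add: algebra_simps)
    also have "\<dots> \<le> norm (X \<omega> - y)"
      by (rule resolvent_contraction[OF mono[OF measurable_space[OF Y]] \<open>\<gamma> > 0\<close> Z p(1)]) (use * in auto)
    also have "\<dots> < 2 * r n"
      using dist_triangle[of "X \<omega>" y z] * p by (simp add: dist_norm)
    finally have "dist q (Z \<omega>) < 3 * r n"
      using p dist_triangle[of q "Z \<omega>" p] by (simp add: dist_norm norm_minus_commute)
    then show "\<omega> \<in> Z -` U \<inter> space N" using * by auto
  qed
  show "Z -` U \<inter> space N \<in> sets N"
    unfolding eq using \<open>countable P\<close>
    by (intro sets.countable_UN'') (auto split: prod.split)
qed

section \<open>Independence of the iterates from later samples\<close>

text \<open>Independence only concerns the generated sigma-algebras, and those of \<open>X'\<close>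
  and \<open>Y'\<close> are contained in those of \<open>X\<close> and \<open>Y\<close>. Thus
  \<open>X'\<close> need not be written as a function of \<open>X\<close>.\<close>

lemma (in prob_space) indep_var_vimage_algebra:
  assumes XY: "indep_var S X T Y"
    and X': "X' \<in> measurable (vimage_algebra (space M) X S) S'"
    and Y': "Y' \<in> measurable (vimage_algebra (space M) Y T) T'"
  shows "indep_var S' X' T' Y'"
proof -
  have rv: "random_variable S X" "random_variable T Y"
    and ind: "indep_set (sets (vimage_algebra (space M) X S)) (sets (vimage_algebra (space M) Y T))"
    using XY by (auto simp: indep_var_eq sets_vimage_algebra)
  have sub: "sigma_sets (space M) {Z -` B \<inter> space M | B. B \<in> sets R}
      \<subseteq> sets (vimage_algebra (space M) V Q)"
    if "Z \<in> measurable (vimage_algebra (space M) V Q) R" for Z V and R :: "'y measure" and Q :: "'z measure"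
    using sets.sigma_sets_subset[of "{Z -` B \<inter> space M | B. B \<in> sets R}" "vimage_algebra (space M) V Q"]
      measurable_sets[OF that] by auto
  have subM: "sets (vimage_algebra (space M) V Q) \<subseteq> events"
    if "random_variable Q V" for V and Q :: "'z measure"
    unfolding sets_vimage_algebra using measurable_sets[OF that] by (intro sets.sigma_sets_subset) auto
  have "random_variable S' X'" "random_variable T' Y'"
    using measurable_mono[OF order_refl refl subM[OF rv(1)], of S'] X'
      measurable_mono[OF order_refl refl subM[OF rv(2)], of T'] Y' by auto
  moreover have "indep_set (sigma_sets (space M) {X' -` B \<inter> space M | B. B \<in> sets S'})
      (sigma_sets (space M) {Y' -` B \<inter> space M | B. B \<in> sets T'})"
    using ind sub[OF X'] sub[OF Y'] unfolding indep_sets2_eq by blast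
  ultimately show ?thesis by (simp add: indep_var_eq)
qed

text \<open>Expanding the inner product over the basis reduces both claims to products of
  independent real coordinates.\<close>

lemma (in prob_space) indep_var_inner:
  fixes X Y :: "'a \<Rightarrow> 'b::euclidean_space"
  assumes ind: "indep_var borel X borel Y" and X: "integrable M X" and Y: "integrable M Y"
  shows "integrable M (\<lambda>\<omega>. X \<omega> \<bullet> Y \<omega>)"
    and "expectation (\<lambda>\<omega>. X \<omega> \<bullet> Y \<omega>) = expectation X \<bullet> expectation Y"
proof -
  have ind': "indep_var borel (\<lambda>\<omega>. X \<omega> \<bullet> b) borel (\<lambda>\<omega>. Y \<omega> \<bullet> b)" for b
    using indep_var_compose[OF ind, of "\<lambda>v. v \<bullet> b" borel "\<lambda>v. v \<bullet> b" borel] by (simp add: comp_def)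
  have int: "integrable M (\<lambda>\<omega>. (X \<omega> \<bullet> b) * (Y \<omega> \<bullet> b))" for b
    by (rule indep_var_integrable[OF ind']) (use X Y in auto)
  show "integrable M (\<lambda>\<omega>. X \<omega> \<bullet> Y \<omega>)"
    by (subst euclidean_inner) (use int in auto)
  show "expectation (\<lambda>\<omega>. X \<omega> \<bullet> Y \<omega>) = expectation X \<bullet> expectation Y"
    by (subst (1 2) euclidean_inner)
      (use int X Y in \<open>simp add: indep_var_lebesgue_integral[OF ind']\<close>)
qed

text \<open>It serves to separate the iterate \<open>x j\<close>, determined by the samples before
  \<open>j\<close>, from the sample \<open>\<xi> j\<close>.\<close>

lemma (in prob_space) indep_var_restrict_adapted:
  assumes ind: "indep_vars D \<xi> UNIV" and "J \<inter> K = {}"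
    and X: "X \<in> measurable (vimage_algebra (space M) (\<lambda>\<omega>. \<lambda>i\<in>J. \<xi> i \<omega>) (PiM J D)) S"
    and Y: "Y \<in> measurable (vimage_algebra (space M) (\<lambda>\<omega>. \<lambda>i\<in>K. \<xi> i \<omega>) (PiM K D)) T"
  shows "indep_var S X T Y"
  using indep_var_vimage_algebra[OF indep_var_restrict[OF ind \<open>J \<inter> K = {}\<close>] X Y] by simp

lemma measurable_component_vimage_algebra:
  assumes "\<And>i. i \<in> J \<Longrightarrow> \<xi> i \<in> \<Omega> \<rightarrow> space (D i)" and "j \<in> J"
  shows "\<xi> j \<in> measurable (vimage_algebra \<Omega> (\<lambda>\<omega>. \<lambda>i\<in>J. \<xi> i \<omega>) (PiM J D)) (D j)"
proof -
  have "(\<lambda>\<omega>. \<lambda>i\<in>J. \<xi> i \<omega>) \<in> measurable (vimage_algebra \<Omega> (\<lambda>\<omega>. \<lambda>i\<in>J. \<xi> i \<omega>) (PiM J D)) (PiM J D)"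
    using assms(1) by (intro measurable_vimage_algebra1) (auto simp: space_PiM Pi_iff)
  from measurable_compose[OF this measurable_component_singleton[OF \<open>j \<in> J\<close>]] show ?thesis
    using \<open>j \<in> J\<close> by simp
qed

section \<open>The recursion for the mean squared error\<close>

lemma (in prob_space) mean_sq_contraction_step:
  fixes X G Z :: "'a \<Rightarrow> 'b::euclidean_space"
  assumes ind: "indep_var borel X borel G"
    and X: "integrable M (\<lambda>\<omega>. (norm (X \<omega>))\<^sup>2)"
    and G: "integrable M G" "expectation G = 0" "integrable M (\<lambda>\<omega>. (norm (G \<omega>))\<^sup>2)"
    and Z[measurable]: "Z \<in> borel_measurable M"
    and "c > 0" and contr: "\<And>\<omega>. \<omega> \<in> space M \<Longrightarrow> c * norm (Z \<omega>) \<le> norm (X \<omega> - \<gamma> *\<^sub>R G \<omega>)"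
  shows "integrable M (\<lambda>\<omega>. (norm (Z \<omega>))\<^sup>2)"
    and "expectation (\<lambda>\<omega>. (norm (Z \<omega>))\<^sup>2) \<le>
      (expectation (\<lambda>\<omega>. (norm (X \<omega>))\<^sup>2) + \<gamma>\<^sup>2 * expectation (\<lambda>\<omega>. (norm (G \<omega>))\<^sup>2)) / c\<^sup>2"
proof -
  have X_meas[measurable]: "X \<in> borel_measurable M" using indep_var_rv1[OF ind] .
  have X_int: "integrable M X"
  proof (rule Bochner_Integration.integrable_bound)
    show "integrable M (\<lambda>\<omega>. 1 + (norm (X \<omega>))\<^sup>2)" using X by auto
    \<comment> \<open>From \<open>0 \<le> (norm v - 1)\<^sup>2\<close> follows
      \<open>2 * norm v \<le> 1 + (norm v)\<^sup>2\<close>, so a finite second moment gives a finite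
      first one.\<close>
    have "norm v \<le> norm (1 + (norm v)\<^sup>2)" for v :: 'b
      using zero_le_power2[of "norm v - 1"] norm_ge_zero[of v]
      unfolding power2_diff real_norm_def one_power2 by linarith
    then show "AE \<omega> in M. norm (X \<omega>) \<le> norm (1 + (norm (X \<omega>))\<^sup>2)" by simp
  qed simp
  note cross = indep_var_inner[OF ind X_int G(1)]
  \<comment> \<open>The expanded square of \<open>X - \<gamma> *\<^sub>R G\<close> over
    \<open>c\<^sup>2\<close>: a pointwise bound for the squared norm of \<open>Z\<close> whose cross
    term has expectation zero.\<close>
  define F where "F \<omega> = ((norm (X \<omega>))\<^sup>2 - 2 * \<gamma> * (X \<omega> \<bullet> G \<omega>) + \<gamma>\<^sup>2 * (norm (G \<omega>))\<^sup>2) / c\<^sup>2" for \<omega>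
  have F_int: "integrable M F"
    unfolding F_def using X G cross(1) by auto
  have le: "(norm (Z \<omega>))\<^sup>2 \<le> F \<omega>" if "\<omega> \<in> space M" for \<omega>
  proof -
    have "(c * norm (Z \<omega>))\<^sup>2 \<le> (norm (X \<omega> - \<gamma> *\<^sub>R G \<omega>))\<^sup>2"
      using contr[OF that] \<open>c > 0\<close> by (intro power_mono) auto
    also have "\<dots> = (norm (X \<omega>))\<^sup>2 - 2 * \<gamma> * (X \<omega> \<bullet> G \<omega>) + \<gamma>\<^sup>2 * (norm (G \<omega>))\<^sup>2"
      unfolding power2_norm_eq_inner
      by (simp add: inner_diff_left inner_diff_right inner_commute power2_eq_square algebra_simps)
    also have "\<dots> = c\<^sup>2 * F \<omega>"
      using \<open>c > 0\<close> by (simp add: F_def)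
    finally show ?thesis using \<open>c > 0\<close> by (simp add: power_mult_distrib)
  qed
  show Z_int: "integrable M (\<lambda>\<omega>. (norm (Z \<omega>))\<^sup>2)"
  proof (rule Bochner_Integration.integrable_bound[OF F_int])
    show "AE \<omega> in M. norm ((norm (Z \<omega>))\<^sup>2) \<le> norm (F \<omega>)"
      by (rule AE_I2) (use le in \<open>fastforce intro: order_trans\<close>)
  qed measurable
  have "expectation (\<lambda>\<omega>. (norm (Z \<omega>))\<^sup>2) \<le> expectation F"
    by (rule integral_mono[OF Z_int F_int le])
  also have "\<dots> = (expectation (\<lambda>\<omega>. (norm (X \<omega>))\<^sup>2) + \<gamma>\<^sup>2 * expectation (\<lambda>\<omega>. (norm (G \<omega>))\<^sup>2)) / c\<^sup>2"
    unfolding F_def using X G cross by simp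
  finally show "expectation (\<lambda>\<omega>. (norm (Z \<omega>))\<^sup>2) \<le>
      (expectation (\<lambda>\<omega>. (norm (X \<omega>))\<^sup>2) + \<gamma>\<^sup>2 * expectation (\<lambda>\<omega>. (norm (G \<omega>))\<^sup>2)) / c\<^sup>2" .
qed

text \<open>With \<open>Q = c\<^sup>2\<close> and \<open>r = (1 / Q) ^ k\<close>, the coefficient of
  \<open>v\<close> is the geometric sum of the first \<open>k\<close> powers of
  \<open>1 / Q\<close>, starting from the first power. Adding 1 and dividing by \<open>Q\<close>
  appends one more term.\<close>

lemma contraction_recursion_solution:
  fixes c d v :: real
  assumes "c > 1"
  shows "((1 / c) ^ (2 * k) * d + (1 - c powi (- 2 * int k)) / (c\<^sup>2 - 1) * v + v) / c\<^sup>2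
    = (1 / c) ^ (2 * Suc k) * d + (1 - c powi (- 2 * int (Suc k))) / (c\<^sup>2 - 1) * v"
proof -
  have *: "c powi (- 2 * int j) = (1 / c\<^sup>2) ^ j" for j
    by (simp add: power_int_minus power_int_mult power_one_over inverse_eq_divide flip: power_mult)
  have "(r * d + (1 - r) / (Q - 1) * v + v) / Q = r * (1 / Q) * d + (1 - r * (1 / Q)) / (Q - 1) * v"
    if "Q > 1" for r Q :: real
    using that by (simp add: divide_simps) (simp add: algebra_simps)
  moreover have **: "(1 / c) ^ (2 * j) = (1 / c\<^sup>2) ^ j" for j
    by (simp add: power_mult power_one_over)
  moreover have "c\<^sup>2 > 1" using assms by simp
  ultimately show ?thesis
    unfolding * ** power_Suc2 by blast
qed

theorem theorem1:
  fixes D :: "'s measure"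
    and A :: "'s \<Rightarrow> 'a::euclidean_space \<Rightarrow> 'a set"
    and \<mu> \<gamma> :: real
    and xstar x0 :: 'a
    and astar :: "'s \<Rightarrow> 'a"
    and \<sigma>star_sq :: ennreal
    and M :: "'w measure"
    and \<xi> :: "nat \<Rightarrow> 'w \<Rightarrow> 's"
    and x :: "nat \<Rightarrow> 'w \<Rightarrow> 'a"
    and k :: nat
  assumes "prob_space D"
    and "\<mu> > 0"
    and "\<And>s. s \<in> space D \<Longrightarrow> strongly_maximally_monotone \<mu> (A s)"
    and "measurable_op_family D A"
    and "0 \<in> mean_op D A xstar"
    and "is_arg_min (mean_sq_norm D) (\<lambda>a. a \<in> selections D A xstar 0) astar"
    and "\<sigma>star_sq = mean_sq_norm D astar"
    and "\<gamma> > 0"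
    and "prob_space M"
    and "prob_space.indep_vars M (\<lambda>_. D) \<xi> UNIV"
    and "\<And>i. distr M D (\<xi> i) = D"
    and "\<And>\<omega>. \<omega> \<in> space M \<Longrightarrow> x 0 \<omega> = x0"
    and "\<And>i \<omega>. \<omega> \<in> space M \<Longrightarrow>
           x (Suc i) \<omega> \<in> resolvent (scale_op \<gamma> (A (\<xi> i \<omega>))) (x i \<omega>)"
  shows "mean_sq_norm M (\<lambda>\<omega>. x k \<omega> - xstar)
      \<le> ennreal ((1 / (1 + \<gamma> * \<mu>)) ^ (2 * k) * (norm (x0 - xstar))\<^sup>2)
        + ennreal ((1 - (1 + \<gamma> * \<mu>) powi (- 2 * int k)) / ((1 + \<gamma> * \<mu>)\<^sup>2 - 1) * \<gamma>\<^sup>2) * \<sigma>star_sq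
    \<and> ennreal ((1 / (1 + \<gamma> * \<mu>)) ^ (2 * k) * (norm (x0 - xstar))\<^sup>2)
        + ennreal ((1 - (1 + \<gamma> * \<mu>) powi (- 2 * int k)) / ((1 + \<gamma> * \<mu>)\<^sup>2 - 1) * \<gamma>\<^sup>2) * \<sigma>star_sq
      \<le> ennreal ((1 / (1 + \<gamma> * \<mu>)) ^ (2 * k) * (norm (x0 - xstar))\<^sup>2)
        + ennreal (\<gamma> / (2 * \<mu> + \<gamma> * \<mu>\<^sup>2)) * \<sigma>star_sq"
proof -
  interpret D: prob_space D by fact
  interpret M: prob_space M by fact
  note mono = assms(3) and step = assms(13) and ind = assms(10)
  have "\<mu> > 0" "\<gamma> > 0" by fact+
  define c where "c = 1 + \<gamma> * \<mu>"
  have "c > 1" using \<open>\<mu> > 0\<close> \<open>\<gamma> > 0\<close> by (simp add: c_def)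
  have "c\<^sup>2 - 1 > 0" using \<open>c > 1\<close> by simp
  have c_eq: "c\<^sup>2 - 1 = \<gamma> * (2 * \<mu> + \<gamma> * \<mu>\<^sup>2)"
    by (simp add: c_def power2_eq_square algebra_simps)
  define q where "q j = (1 - c powi (- 2 * int j)) / (c\<^sup>2 - 1)" for j
  have powi_le: "c powi (- 2 * int j) \<le> 1" for j
    using \<open>c > 1\<close> by (simp add: power_int_minus power_int_mult field_simps one_le_power flip: power_mult)
  have powi_pos: "c powi j > 0" for j
    using \<open>c > 1\<close> by simp
  have q_nonneg: "q j \<ge> 0" for j
    using powi_le[of j] \<open>c\<^sup>2 - 1 > 0\<close> by (simp add: q_def)

  have "astar \<in> selections D A xstar 0"
    using assms(6) by (simp add: is_arg_min_def)
  then have astar: "\<And>s. s \<in> space D \<Longrightarrow> astar s \<in> A s xstar" "integrable D astar" "(\<integral>s. astar s \<partial>D) = 0"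
    by (auto simp: selections_def)
  then have [measurable]: "astar \<in> borel_measurable D" by auto
  have \<xi>[measurable]: "\<xi> i \<in> measurable M D" for i
    using ind by (auto simp: M.indep_vars_def)

  have "mean_sq_norm M (\<lambda>\<omega>. x k \<omega> - xstar)
      \<le> ennreal ((1 / c) ^ (2 * k) * (norm (x0 - xstar))\<^sup>2) + ennreal (q k * \<gamma>\<^sup>2) * \<sigma>star_sq"
  \<comment> \<open>At \<open>k = 0\<close> the coefficient \<open>q 0\<close> vanishes and the
    product of 0 and infinity is 0 in \<open>ennreal\<close>, so the bound has content even if
    \<open>\<sigma>star_sq\<close> is infinite. For \<open>k > 0\<close> the coefficient is
    positive, and an infinite \<open>\<sigma>star_sq\<close> makes the bound trivial.\<close>
  proof (cases "k = 0")
    case True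
    have "mean_sq_norm M (\<lambda>\<omega>. x k \<omega> - xstar) = (\<integral>\<^sup>+ \<omega>. ennreal ((norm (x0 - xstar))\<^sup>2) \<partial>M)"
      unfolding mean_sq_norm_def by (rule nn_integral_cong) (simp add: True assms(12))
    then show ?thesis by (simp add: True M.emeasure_space_1 q_def)
  next
    case False
    show ?thesis
    proof (cases "\<sigma>star_sq = \<infinity>")
      case True
      have "c powi (- 2 * int k) < 1"
        using \<open>c > 1\<close> \<open>k \<noteq> 0\<close>
        by (simp add: power_int_minus power_int_mult field_simps one_less_power flip: power_mult)
      then have "q k > 0"
        using \<open>\<gamma> > 0\<close> \<open>c\<^sup>2 - 1 > 0\<close> by (simp add: q_def)
      then have "ennreal (q k * \<gamma>\<^sup>2) * \<sigma>star_sq = \<infinity>"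
        using \<open>\<gamma> > 0\<close> by (simp add: True ennreal_mult_eq_top_iff)
      then show ?thesis by simp
    next
      case finite: False
      have astar_sq: "integrable D (\<lambda>s. (norm (astar s))\<^sup>2)"
        using finite assms(7) by (intro integrableI_bounded) (auto simp: mean_sq_norm_def less_top)
      define v where "v = (\<integral>s. (norm (astar s))\<^sup>2 \<partial>D)"
      have v: "\<sigma>star_sq = ennreal v" "v \<ge> 0"
        using nn_integral_eq_integral[OF astar_sq] assms(7) by (auto simp: v_def mean_sq_norm_def)

      define G where "G i = (\<lambda>\<omega>. astar (\<xi> i \<omega>))" for i
      \<comment> \<open>Each \<open>\<xi> i\<close> has law \<open>D\<close>, so the moments of
        \<open>astar\<close> carry over to \<open>G i\<close>.\<close>
      have G: "integrable M (G i)" "M.expectation (G i) = 0"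
        "integrable M (\<lambda>\<omega>. (norm (G i \<omega>))\<^sup>2)" "M.expectation (\<lambda>\<omega>. (norm (G i \<omega>))\<^sup>2) = v" for i
        using astar astar_sq integrable_distr_eq[OF \<xi>, of astar i] integral_distr[OF \<xi>, of astar i]
          integrable_distr_eq[OF \<xi>, of "\<lambda>s. (norm (astar s))\<^sup>2" i]
          integral_distr[OF \<xi>, of "\<lambda>s. (norm (astar s))\<^sup>2" i]
        by (simp_all add: assms(11) G_def v_def)

      define F where "F J = vimage_algebra (space M) (\<lambda>\<omega>. \<lambda>i\<in>J. \<xi> i \<omega>) (PiM J (\<lambda>_. D))" for J
      have space_F: "space (F J) = space M" for J
        by (simp add: F_def)
      have \<xi>_F: "\<xi> i \<in> measurable (F J) D" if "i \<in> J" for i J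
        unfolding F_def using measurable_space[OF \<xi>] that
        by (intro measurable_component_vimage_algebra[where D = "\<lambda>_. D"]) auto
      \<comment> \<open>The sigma-algebra \<open>N\<close> is left open because two are needed: the
        one generated by the samples before \<open>j\<close>, for independence, and that of
        \<open>M\<close>, for integrability. The strict \<open>i < j\<close> reflects that
        \<open>\<xi> j\<close> first enters in \<open>x (Suc j)\<close>.\<close>
      have x_meas: "x j \<in> borel_measurable N"
        if "space N = space M" "\<And>i. i < j \<Longrightarrow> \<xi> i \<in> measurable N D" for j N
        using that(2)
      proof (induction j)
        case 0
        then show ?case using measurable_cong[of N "x 0" "\<lambda>_. x0" borel] assms(12) that(1) by simp
      next
        case (Suc j)
        show ?case
          by (rule borel_measurable_resolvent_step[where D = D and X = "x j" and Y = "\<xi> j" and \<gamma> = \<gamma>,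
                OF assms(4) mono \<open>\<mu> > 0\<close> \<open>\<gamma> > 0\<close>])
            (use Suc step that(1) in auto)
      qed
      have ind_G: "M.indep_var borel (\<lambda>\<omega>. x j \<omega> - xstar) borel (G j)" for j
      proof (rule M.indep_var_restrict_adapted[OF ind])
        show "{..<j} \<inter> {j} = {}" by simp
        have "x j \<in> borel_measurable (F {..<j})"
          by (rule x_meas) (auto intro: \<xi>_F simp: space_F)
        then show "(\<lambda>\<omega>. x j \<omega> - xstar) \<in> borel_measurable
            (vimage_algebra (space M) (\<lambda>\<omega>. \<lambda>i\<in>{..<j}. \<xi> i \<omega>) (PiM {..<j} (\<lambda>_. D)))"
          unfolding F_def by measurable
        show "G j \<in> borel_measurable
            (vimage_algebra (space M) (\<lambda>\<omega>. \<lambda>i\<in>{j}. \<xi> i \<omega>) (PiM {j} (\<lambda>_. D)))"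
          unfolding G_def F_def[symmetric]
          by (rule measurable_compose[OF \<xi>_F]) auto
      qed

      have contr: "c * norm (x (Suc j) \<omega> - xstar) \<le> norm (x j \<omega> - xstar - \<gamma> *\<^sub>R G j \<omega>)"
        if "\<omega> \<in> space M" for j \<omega>
      proof -
        have "\<xi> j \<omega> \<in> space D" using measurable_space[OF \<xi> that] .
        then have "xstar \<in> resolvent (scale_op \<gamma> (A (\<xi> j \<omega>))) (xstar + \<gamma> *\<^sub>R G j \<omega>)"
          using astar(1) by (auto simp: resolvent_scale_op_iff G_def)
        from resolvent_contraction[OF mono[OF \<open>\<xi> j \<omega> \<in> space D\<close>] \<open>\<gamma> > 0\<close> step[OF that] this]
        show ?thesis by (simp add: c_def algebra_simps)
      qed

      \<comment> \<open>Integrability is carried through the induction because the contraction step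
        assumes it of the current iterate; it also allows the return from real expectations to
        \<open>ennreal\<close>.\<close>
      have bound: "integrable M (\<lambda>\<omega>. (norm (x j \<omega> - xstar))\<^sup>2) \<and>
          M.expectation (\<lambda>\<omega>. (norm (x j \<omega> - xstar))\<^sup>2)
            \<le> (1 / c) ^ (2 * j) * (norm (x0 - xstar))\<^sup>2 + q j * (\<gamma>\<^sup>2 * v)" for j
      proof (induction j)
        case 0
        have "integrable M (\<lambda>\<omega>. (norm (x 0 \<omega> - xstar))\<^sup>2) \<longleftrightarrow>
            integrable M (\<lambda>\<omega>. (norm (x0 - xstar))\<^sup>2)"
          by (rule Bochner_Integration.integrable_cong) (simp_all add: assms(12))
        moreover have "M.expectation (\<lambda>\<omega>. (norm (x 0 \<omega> - xstar))\<^sup>2) =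
            M.expectation (\<lambda>\<omega>. (norm (x0 - xstar))\<^sup>2)"
          by (rule Bochner_Integration.integral_cong) (simp_all add: assms(12))
        ultimately show ?case by (simp add: q_def M.prob_space)
      next
        case (Suc j)
        have "x (Suc j) \<in> borel_measurable M" by (rule x_meas) auto
        then have Z: "(\<lambda>\<omega>. x (Suc j) \<omega> - xstar) \<in> borel_measurable M" by measurable
        have "c > 0" using \<open>c > 1\<close> by simp
        note S = M.mean_sq_contraction_step[OF ind_G conjunct1[OF Suc] G(1-3) Z \<open>c > 0\<close> contr]
        have "M.expectation (\<lambda>\<omega>. (norm (x (Suc j) \<omega> - xstar))\<^sup>2)
            \<le> (M.expectation (\<lambda>\<omega>. (norm (x j \<omega> - xstar))\<^sup>2) + \<gamma>\<^sup>2 * v) / c\<^sup>2"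
          using S(2) by (simp add: G(4))
        also have "\<dots> \<le> ((1 / c) ^ (2 * j) * (norm (x0 - xstar))\<^sup>2 + q j * (\<gamma>\<^sup>2 * v) + \<gamma>\<^sup>2 * v) / c\<^sup>2"
          using Suc by (intro divide_right_mono add_right_mono) auto
        also have "\<dots> = (1 / c) ^ (2 * Suc j) * (norm (x0 - xstar))\<^sup>2 + q (Suc j) * (\<gamma>\<^sup>2 * v)"
          unfolding q_def by (rule contraction_recursion_solution[OF \<open>c > 1\<close>])
        finally show ?case using S(1) by simp
      qed
      have "mean_sq_norm M (\<lambda>\<omega>. x k \<omega> - xstar) = ennreal (M.expectation (\<lambda>\<omega>. (norm (x k \<omega> - xstar))\<^sup>2))"
        unfolding mean_sq_norm_def using bound[of k] by (intro nn_integral_eq_integral) auto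
      also have "\<dots> \<le> ennreal ((1 / c) ^ (2 * k) * (norm (x0 - xstar))\<^sup>2 + q k * \<gamma>\<^sup>2 * v)"
        using bound[of k] by (intro ennreal_leI) (simp add: mult.assoc)
      also have "\<dots> = ennreal ((1 / c) ^ (2 * k) * (norm (x0 - xstar))\<^sup>2) + ennreal (q k * \<gamma>\<^sup>2) * \<sigma>star_sq"
        using q_nonneg[of k] v(2) \<open>c > 1\<close> by (simp add: v(1) ennreal_plus flip: ennreal_mult)
      finally show ?thesis .
    qed
  qed
  moreover have "q k * \<gamma>\<^sup>2 \<le> \<gamma> / (2 * \<mu> + \<gamma> * \<mu>\<^sup>2)"
  proof -
    \<comment> \<open>Dropping the positive power of \<open>c\<close> replaces the finite geometric
      sum by the full series; \<open>c_eq\<close> then cancels one factor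
      \<open>\<gamma>\<close>.\<close>
    have "q k * \<gamma>\<^sup>2 \<le> 1 / (c\<^sup>2 - 1) * \<gamma>\<^sup>2"
      unfolding q_def using powi_pos[of "- 2 * int k"] \<open>c\<^sup>2 - 1 > 0\<close>
      by (intro mult_right_mono divide_right_mono) auto
    also have "\<dots> = \<gamma> / (2 * \<mu> + \<gamma> * \<mu>\<^sup>2)"
      using \<open>\<gamma> > 0\<close> unfolding c_eq by (simp add: power2_eq_square)
    finally show ?thesis .
  qed
  ultimately show ?thesis
    unfolding q_def c_def by (auto intro!: add_left_mono mult_right_mono ennreal_leI)
qed

end
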